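(* Assume the setup of the context and that $\mu$ is not a Dirac mass. Then for every matrix $F\in\mathbb R^{d^+\times d^-}$ there exists an admissible $v$ such that the limit defining $E_0(v)$ exists and $E_0(v)=F$.
   Context: Let $r\ge1$, $\Lambda\subset\mathbb R^m$ compact, and $g\in C^r(\mathbb R^m,\mathbb R^m)$ such that $\Lambda$ is invariant under the flow $g_t$ of $\dot y=g(y)$. Let $\mu$ be a Borel probability measure on $\Lambda$ that is $g_t$-invariant, ergodic and mixing. Let $R\in\mathbb R^{m\times m}$ with $R^2=I$, $R(\Lambda)=\Lambda$, $\mu$ $R$-invariant, and $g(Ry)=-Rg(y)$ for all $y\in\Lambda$. Let $d=d^++d^-$ and $A=\mathrm{diag}(I_{d^+},-I_{d^-})$. A function $v\in C^r(\mathbb R^m,\mathbb R^d)$ is admissible if $v(Ry)=Av(y)$ for all $y\in\Lambda$ and $\int_\Lambda v\,d\mu=0$; write $v=(v^+,v^-)$ with $v^\pm$ valued in $\mathbb R^{d^\pm}$ and set $E_0(v)=2\lim_{T\to\infty}\int_0^T\int_\Lambda v^+\otimes(v^-\circ g_t)\,d\mu\,dt\in\mathbb R^{d^+\times d^-}$, where $u\otimes w=uw^T$. *)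

theory Defs
  imports "HOL-Analysis.Analysis" "HOL-Probability.Probability"
begin

fun Ck :: "nat \<Rightarrow> ('a::euclidean_space \<Rightarrow> 'b::real_normed_vector) \<Rightarrow> bool" where
  "Ck 0 f = continuous_on UNIV f"
| "Ck (Suc k) f = ((\<forall>x. f differentiable (at x)) \<and>
                   (\<forall>h. Ck k (\<lambda>x. frechet_derivative f (at x) h)))"

definition is_flow_on ::
  "('a::real_normed_vector \<Rightarrow> 'a) \<Rightarrow> 'a set \<Rightarrow> (real \<Rightarrow> 'a \<Rightarrow> 'a) \<Rightarrow> bool" where
  "is_flow_on g Lam phi \<longleftrightarrow>
     (\<forall>y\<in>Lam. phi 0 y = y \<and>
        (\<forall>t. phi t y \<in> Lam \<and> ((\<lambda>s. phi s y) has_vector_derivative g (phi t y)) (at t)))"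

definition measure_preserving :: "'a measure \<Rightarrow> ('a \<Rightarrow> 'a) \<Rightarrow> bool" where
  "measure_preserving M f \<longleftrightarrow> f \<in> measurable M M \<and> distr M M f = M"

definition flow_invariant :: "'a measure \<Rightarrow> (real \<Rightarrow> 'a \<Rightarrow> 'a) \<Rightarrow> bool" where
  "flow_invariant M phi \<longleftrightarrow> (\<forall>t. measure_preserving M (phi t))"

definition flow_ergodic :: "'a measure \<Rightarrow> (real \<Rightarrow> 'a \<Rightarrow> 'a) \<Rightarrow> bool" where
  "flow_ergodic M phi \<longleftrightarrow>
     (\<forall>A\<in>sets M. (\<forall>t. phi t -` A \<inter> space M = A) \<longrightarrow>
                  measure M A = 0 \<or> measure M A = 1)"

definition flow_mixing :: "'a measure \<Rightarrow> (real \<Rightarrow> 'a \<Rightarrow> 'a) \<Rightarrow> bool" where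
  "flow_mixing M phi \<longleftrightarrow>
     (\<forall>A\<in>sets M. \<forall>B\<in>sets M.
        ((\<lambda>t. measure M (A \<inter> (phi t -` B \<inter> space M))) \<longlongrightarrow> measure M A * measure M B) at_top)"

definition is_dirac :: "'a measure \<Rightarrow> bool" where
  "is_dirac M \<longleftrightarrow> (\<exists>y\<in>space M. \<forall>A\<in>sets M. emeasure M A = indicator A y)"

definition Adiag :: "('p::ab_group_add) \<times> ('q::ab_group_add) \<Rightarrow> 'p \<times> 'q" where
  "Adiag w = (fst w, - snd w)"

definition outer :: "real^'p \<Rightarrow> real^'q \<Rightarrow> real^'q^'p" where
  "outer u w = (\<chi> i j. u $ i * w $ j)"

definition admissible ::
  "nat \<Rightarrow> real^'m::finite^'m \<Rightarrow> (real^'m) measure \<Rightarrow> (real^'m \<Rightarrow> (real^'p::finite) \<times> (real^'q::finite)) \<Rightarrow> bool" where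
  "admissible r R M v \<longleftrightarrow> Ck r v \<and> (\<forall>y\<in>space M. v (R *v y) = Adiag (v y))
      \<and> (LINT y|M. v y) = 0"

definition corr :: "(real^'m::finite) measure \<Rightarrow> (real \<Rightarrow> real^'m \<Rightarrow> real^'m)
    \<Rightarrow> (real^'m::finite \<Rightarrow> (real^'p::finite) \<times> (real^'q::finite)) \<Rightarrow> real \<Rightarrow> real^'q^'p" where
  "corr M phi v t = (LINT y|M. outer (fst (v y)) (snd (v (phi t y))))"

definition E0_eq :: "(real^'m::finite) measure \<Rightarrow> (real \<Rightarrow> real^'m \<Rightarrow> real^'m)
    \<Rightarrow> (real^'m::finite \<Rightarrow> (real^'p::finite) \<times> (real^'q::finite)) \<Rightarrow> real^'q^'p \<Rightarrow> bool" where
  "E0_eq M phi v F \<longleftrightarrow> (\<forall>T\<ge>0. corr M phi v integrable_on {0..T}) \<and>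
     ((\<lambda>T. 2 *\<^sub>R integral {0..T} (corr M phi v)) \<longlongrightarrow> F) at_top"

end

theory Submission
  imports Defs
begin

text \<open>
  Take the odd part to be a coboundary: \<open>v\<^sup>- = dW \<sqdot> g\<close> with \<open>W\<close> smooth and \<open>R\<close>-even. By
  reversibility \<open>v\<^sup>-\<close> is \<open>R\<close>-odd, so it has mean zero, and since it is the derivative of \<open>W\<close>
  along the flow, the time integral telescopes; as \<open>v\<^sup>+\<close> has mean zero, mixing gives
  \<open>E\<^sub>0(v) = - 2 \<integral> v\<^sup>+ \<otimes> W\<close>. It remains to find even \<open>v\<^sup>+\<close> and \<open>W\<close> with prescribed correlations.
  Mixing excludes atoms, so for \<open>a\<close> in the support of the measure the even polynomial
  \<open>P y = |y - a|\<^sup>2 |R y - a|\<^sup>2\<close> is almost surely nonzero but takes arbitrarily small values with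
  positive probability. Hence \<open>1, P, P\<^sup>2, \<dots>\<close> are linearly independent in \<open>L\<^sup>2\<close>, and the Gram
  matrix of the centred powers of \<open>P\<close> is invertible.
\<close>

section \<open>Stability of the class \<open>Ck\<close> under linear, bilinear and componentwise
  operations\<close>

lemma Ck_const: "Ck k (\<lambda>x. c)"
  by (induction k arbitrary: c) (simp_all add: frechet_derivative_const)

text \<open>Continuity is demanded only at level 0 of the recursion, so the drop in order rests on
  differentiability implying continuity there.\<close>

lemma Ck_SucD: "Ck (Suc k) f \<Longrightarrow> Ck k f"
proof (induction k arbitrary: f)
  case 0
  then show ?case
    by (auto intro!: differentiable_imp_continuous_on simp: differentiable_on_def differentiable_at_withinI)
next
  case (Suc k)
  then show ?case by (metis Ck.simps(2))
qed

lemma frechet_derivative_eqI: "(f has_derivative D) (at x) \<Longrightarrow> frechet_derivative f (at x) = D"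
  using frechet_derivative_at by metis

lemma differentiable_has_derivative:
  "f differentiable (at x) \<Longrightarrow> (f has_derivative (\<lambda>h. frechet_derivative f (at x) h)) (at x)"
  using frechet_derivative_works by blast

lemma Ck_bounded_linear:
  assumes "bounded_linear L"
  shows "Ck k f \<Longrightarrow> Ck k (\<lambda>x. L (f x))"
proof (induction k arbitrary: f)
  case 0
  then show ?case
    using assms by (simp add: bounded_linear.continuous_on)
next
  case (Suc k)
  have D: "((\<lambda>x. L (f x)) has_derivative (\<lambda>h. L (frechet_derivative f (at x) h))) (at x)" for x
    using Suc.prems by (intro bounded_linear.has_derivative[OF assms] differentiable_has_derivative) simp
  then have "frechet_derivative (\<lambda>x. L (f x)) (at x) = (\<lambda>h. L (frechet_derivative f (at x) h))" for x
    by (rule frechet_derivative_eqI)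
  with D Suc show ?case by (auto simp: differentiable_def)
qed

lemma Ck_add: "Ck k f \<Longrightarrow> Ck k g \<Longrightarrow> Ck k (\<lambda>x. f x + g x)"
proof (induction k arbitrary: f g)
  case 0
  then show ?case by (simp add: continuous_on_add)
next
  case (Suc k)
  have D: "((\<lambda>x. f x + g x) has_derivative
      (\<lambda>h. frechet_derivative f (at x) h + frechet_derivative g (at x) h)) (at x)" for x
    using Suc.prems by (intro has_derivative_add differentiable_has_derivative) simp_all
  then have "frechet_derivative (\<lambda>x. f x + g x) (at x) =
      (\<lambda>h. frechet_derivative f (at x) h + frechet_derivative g (at x) h)" for x
    by (rule frechet_derivative_eqI)
  with D Suc show ?case by (auto simp: differentiable_def)
qed

text \<open>By the product rule a directional derivative is a sum of two bilinear terms, each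
  pairing an undifferentiated factor with a differentiated one. All these factors are
  \<open>Ck k\<close>, which closes the induction.\<close>

lemma Ck_bounded_bilinear:
  assumes "bounded_bilinear B"
  shows "Ck k f \<Longrightarrow> Ck k g \<Longrightarrow> Ck k (\<lambda>x. B (f x) (g x))"
proof (induction k arbitrary: f g)
  case 0
  then show ?case using assms by (simp add: bounded_bilinear.continuous_on)
next
  case (Suc k)
  have D: "((\<lambda>x. B (f x) (g x)) has_derivative
      (\<lambda>h. B (f x) (frechet_derivative g (at x) h) + B (frechet_derivative f (at x) h) (g x))) (at x)" for x
    using Suc.prems by (intro bounded_bilinear.FDERIV[OF assms] differentiable_has_derivative) simp_all
  then have eq: "frechet_derivative (\<lambda>x. B (f x) (g x)) (at x) =
      (\<lambda>h. B (f x) (frechet_derivative g (at x) h) + B (frechet_derivative f (at x) h) (g x))" for x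
    by (rule frechet_derivative_eqI)
  have "Ck k f" "Ck k g" using Suc.prems Ck_SucD by blast+
  then have "Ck k (\<lambda>x. B (f x) (frechet_derivative g (at x) h) + B (frechet_derivative f (at x) h) (g x))" for h
    using Suc by (intro Ck_add) (simp_all del: Ck.simps(1))
  with D eq show ?case by (auto simp: differentiable_def)
qed

lemma Ck_linear:
  assumes "bounded_linear L" shows "Ck k L"
proof (cases k)
  case 0
  then show ?thesis using assms by (simp add: linear_continuous_on)
next
  case (Suc l)
  have D: "(L has_derivative L) (at x)" for x
    using assms by (rule bounded_linear_imp_has_derivative)
  then have "frechet_derivative L (at x) = L" for x
    by (rule frechet_derivative_eqI)
  with D Suc Ck_const show ?thesis by (auto simp: differentiable_def)
qed

lemma Ck_sum: "(\<And>i. i \<in> I \<Longrightarrow> Ck k (f i)) \<Longrightarrow> Ck k (\<lambda>x. \<Sum>i\<in>I. f i x)"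
  by (induction I rule: infinite_finite_induct) (auto intro: Ck_const Ck_add)

lemma Ck_diff: "Ck k f \<Longrightarrow> Ck k g \<Longrightarrow> Ck k (\<lambda>x. f x - g x)"
  using Ck_add[of k f "\<lambda>x. - g x"] Ck_bounded_linear[OF bounded_linear_minus[OF bounded_linear_ident], of k g]
  by simp

lemma Ck_power: "Ck k f \<Longrightarrow> Ck k (\<lambda>x. f x ^ n :: real)"
  by (induction n) (auto intro: Ck_const Ck_bounded_bilinear[OF bounded_bilinear_mult])

lemma Ck_Pair:
  assumes "Ck k f" "Ck k g" shows "Ck k (\<lambda>x. (f x, g x))"
proof -
  have "Ck k (\<lambda>x. (f x, 0) + (0, g x))"
    by (intro Ck_add Ck_bounded_linear[OF _ assms(1)] Ck_bounded_linear[OF _ assms(2)])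
       (auto intro!: bounded_linear_Pair bounded_linear_ident bounded_linear_zero)
  then show ?thesis by simp
qed

lemma Ck_vec:
  fixes f :: "'i::finite \<Rightarrow> 'a::euclidean_space \<Rightarrow> real"
  assumes "\<And>i. Ck k (f i)" shows "Ck k (\<lambda>x. \<chi> i. f i x)"
proof -
  have "Ck k (\<lambda>x. \<Sum>i\<in>UNIV. f i x *\<^sub>R (axis i 1 :: real^'i))"
    by (intro Ck_sum Ck_bounded_linear[OF bounded_linear_scaleR_left] assms)
  moreover have "(\<lambda>x. \<Sum>i\<in>UNIV. f i x *\<^sub>R (axis i 1 :: real^'i)) = (\<lambda>x. \<chi> i. f i x)"
    by (auto simp: vec_eq_iff axis_def if_distrib cong: if_cong)
  ultimately show ?thesis by simp
qed

lemma Ck_imp_continuous_on: "Ck k f \<Longrightarrow> continuous_on S f"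
proof (induction k)
  case 0
  then show ?case by (auto intro: continuous_on_subset)
qed (blast dest: Ck_SucD)

section \<open>Mixing for bounded observables and the absence of atoms\<close>

text \<open>Both sides are bilinear in \<open>s\<close> and \<open>u\<close>, and a simple function
  is a finite combination of indicators of its level sets. For a pair of indicators the convergence
  is the definition of mixing.\<close>

lemma mixing_simple_functions:
  fixes s u :: "'a \<Rightarrow> real"
  assumes "prob_space M" and mix: "flow_mixing M phi" and meas: "\<And>t. phi t \<in> measurable M M"
    and s: "simple_function M s" and u: "simple_function M u"
  shows "((\<lambda>t. LINT y|M. s y * u (phi t y)) \<longlongrightarrow> (LINT y|M. s y) * (LINT y|M. u y)) at_top"
proof -
  interpret prob_space M by fact
  define A where "A x = s -` {x} \<inter> space M" for x
  define B where "B x = u -` {x} \<inter> space M" for x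
  have A [measurable]: "A x \<in> sets M" for x
    using s unfolding A_def by (rule simple_functionD)
  have B [measurable]: "B x \<in> sets M" for x
    using u unfolding B_def by (rule simple_functionD)
  have s_eq: "s y = (\<Sum>x\<in>s ` space M. x * indicator (A x) y)" if "y \<in> space M" for y
    unfolding A_def
    by (rule trans[OF simple_function_indicator_representation_banach[OF s that]]) (simp only: real_scaleR_def mult.commute)
  have u_eq: "u y = (\<Sum>x\<in>u ` space M. x * indicator (B x) y)" if "y \<in> space M" for y
    unfolding B_def
    by (rule trans[OF simple_function_indicator_representation_banach[OF u that]]) (simp only: real_scaleR_def mult.commute)
  have C [measurable]: "A x \<inter> (phi t -` B z \<inter> space M) \<in> sets M" for x z t
    using A B meas by (blast intro: sets.Int measurable_sets)
  have su: "(LINT y|M. s y * u (phi t y)) =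
      (\<Sum>x\<in>s ` space M. \<Sum>z\<in>u ` space M. x * z * measure M (A x \<inter> (phi t -` B z \<inter> space M)))" for t
  proof -
    have "(LINT y|M. s y * u (phi t y)) = (LINT y|M. (\<Sum>x\<in>s ` space M. \<Sum>z\<in>u ` space M.
        (x * z) *\<^sub>R indicat_real (A x \<inter> (phi t -` B z \<inter> space M)) y))"
    proof (rule Bochner_Integration.integral_cong)
      fix y assume y: "y \<in> space M"
      then have phi_y: "phi t y \<in> space M" using measurable_space[OF meas] by blast
      have "x * indicat_real (A x) y * (z * indicat_real (B z) (phi t y)) =
          (x * z) *\<^sub>R indicat_real (A x \<inter> (phi t -` B z \<inter> space M)) y" for x z
        using y by (simp add: indicator_def)
      then show "s y * u (phi t y) = (\<Sum>x\<in>s ` space M. \<Sum>z\<in>u ` space M.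
        (x * z) *\<^sub>R indicat_real (A x \<inter> (phi t -` B z \<inter> space M)) y)"
        by (subst s_eq[OF y], subst u_eq[OF phi_y]) (simp only: sum_product)
    qed simp
    also have "\<dots> = (\<Sum>x\<in>s ` space M. \<Sum>z\<in>u ` space M. x * z * measure M (A x \<inter> (phi t -` B z \<inter> space M)))"
    proof -
      have i: "integrable M (\<lambda>y. (x * z) *\<^sub>R indicat_real (A x \<inter> (phi t -` B z \<inter> space M)) y)" for x z
        using C by (intro integrable_scaleR_right integrable_real_indicator) (auto simp: less_top[symmetric])
      have "(LINT y|M. (x * z) *\<^sub>R indicat_real (A x \<inter> (phi t -` B z \<inter> space M)) y) =
          x * z * measure M (A x \<inter> (phi t -` B z \<inter> space M))" for x z
        using sets.sets_into_space[OF C] by (simp only: integral_scaleR_right Bochner_Integration.integral_indicator)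
          (simp add: Int_absorb2)
      then show ?thesis
        by (simp only: Bochner_Integration.integral_sum[OF Bochner_Integration.integrable_sum] Bochner_Integration.integral_sum i)
    qed
    finally show ?thesis .
  qed
  have int: "(LINT y|M. f y) = (\<Sum>x\<in>f ` space M. x * measure M (D x))"
    if "\<And>y. y \<in> space M \<Longrightarrow> f y = (\<Sum>x\<in>f ` space M. x * indicator (D x) y)"
      and [measurable]: "\<And>x. D x \<in> sets M" for f :: "'a \<Rightarrow> real" and D
  proof -
    have "(LINT y|M. f y) = (LINT y|M. (\<Sum>x\<in>f ` space M. x * indicator (D x) y))"
      by (rule Bochner_Integration.integral_cong[OF refl that(1)])
    also have "\<dots> = (\<Sum>x\<in>f ` space M. (LINT y|M. x * indicator (D x) y))"
      by (rule Bochner_Integration.integral_sum) (auto intro!: integrable_real_indicator simp: less_top[symmetric])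
    also have "\<dots> = (\<Sum>x\<in>f ` space M. x * measure M (D x))"
      using that(2) by (simp add: sets.Int_space_eq2)
    finally show ?thesis .
  qed
  have "(LINT y|M. s y) * (LINT y|M. u y) =
      (\<Sum>x\<in>s ` space M. \<Sum>z\<in>u ` space M. x * z * (measure M (A x) * measure M (B z)))"
    by (simp add: int[OF s_eq A] int[OF u_eq B] sum_product mult_ac)
  moreover have "((\<lambda>t. measure M (A x \<inter> (phi t -` B z \<inter> space M))) \<longlongrightarrow> measure M (A x) * measure M (B z)) at_top" for x z
    using mix A B unfolding flow_mixing_def by blast
  ultimately show ?thesis
    unfolding su by (simp only:) (intro tendsto_sum tendsto_mult tendsto_const)
qed

lemma uniform_simple_approximation:
  fixes f :: "'a \<Rightarrow> real"
  assumes [measurable]: "f \<in> borel_measurable M" and bd: "\<And>y. y \<in> space M \<Longrightarrow> \<bar>f y\<bar> \<le> K" and d: "d > 0"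
  obtains s where "simple_function M s" "\<And>y. y \<in> space M \<Longrightarrow> \<bar>f y - s y\<bar> \<le> d"
proof
  \<comment> \<open>Rounding down to the grid of multiples of \<open>d\<close> moves a value by at
    most \<open>d\<close>; boundedness of \<open>f\<close> leaves finitely many grid points.\<close>
  define s where "s y = d * of_int \<lfloor>f y / d\<rfloor>" for y
  have "s ` space M \<subseteq> (\<lambda>k. d * of_int k) ` {\<lfloor>- K / d\<rfloor>..\<lfloor>K / d\<rfloor>}"
  proof
    fix x assume "x \<in> s ` space M"
    then obtain y where y: "y \<in> space M" "x = s y" by blast
    have "- K / d \<le> f y / d" "f y / d \<le> K / d"
      using bd[OF y(1)] d by (intro divide_right_mono; linarith)+
    then show "x \<in> (\<lambda>k. d * of_int k) ` {\<lfloor>- K / d\<rfloor>..\<lfloor>K / d\<rfloor>}"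
      unfolding y(2) s_def by (intro imageI) (auto intro: floor_mono)
  qed
  then have "finite (s ` space M)" by (rule finite_subset) simp
  moreover have "s \<in> borel_measurable M" unfolding s_def by measurable
  ultimately show "simple_function M s" by (rule simple_function_borel_measurable[rotated])
  show "\<bar>f y - s y\<bar> \<le> d" for y
  proof -
    have "f y - s y = d * (f y / d - of_int \<lfloor>f y / d\<rfloor>)"
      using d by (simp add: s_def algebra_simps)
    moreover have "\<bar>f y / d - of_int \<lfloor>f y / d\<rfloor>\<bar> \<le> 1" by linarith
    ultimately show ?thesis using d by (simp add: abs_mult)
  qed
qed

text \<open>Serves both for the integrands pointwise and for the product of their means. The
  condition \<open>d \<le> 1\<close> is what bounds \<open>a'\<close> by
  \<open>K + 1\<close>.\<close>

lemma abs_mult_diff_le: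
  fixes a b a' b' :: real
  assumes "\<bar>a - a'\<bar> \<le> d" "\<bar>b - b'\<bar> \<le> d" "\<bar>a\<bar> \<le> K" "\<bar>b\<bar> \<le> K" "d \<le> 1"
  shows "\<bar>a * b - a' * b'\<bar> \<le> (2 * K + 1) * d"
proof -
  have "a * b - a' * b' = (a - a') * b + a' * (b - b')" by (simp add: algebra_simps)
  also have "\<bar>\<dots>\<bar> \<le> \<bar>a - a'\<bar> * \<bar>b\<bar> + \<bar>a'\<bar> * \<bar>b - b'\<bar>"
    by (metis abs_mult abs_triangle_ineq)
  also have "\<dots> \<le> d * K + (K + 1) * d"
    using assms by (intro add_mono mult_mono) linarith+
  finally show ?thesis by (simp add: algebra_simps)
qed

text \<open>Uniform approximation by simple functions changes the correlation at every time, and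
  also its expected limit, by at most a multiple of the error that does not depend on
  \<open>t\<close>. So convergence passes from simple functions to bounded ones.\<close>

lemma mixing_bounded_functions:
  fixes f h :: "'a \<Rightarrow> real"
  assumes "prob_space M" and mix: "flow_mixing M phi" and meas [measurable]: "\<And>t. phi t \<in> measurable M M"
    and f [measurable]: "f \<in> borel_measurable M" and h [measurable]: "h \<in> borel_measurable M"
    and fK: "\<And>y. y \<in> space M \<Longrightarrow> \<bar>f y\<bar> \<le> K" and hK: "\<And>y. y \<in> space M \<Longrightarrow> \<bar>h y\<bar> \<le> K"
  shows "((\<lambda>t. LINT y|M. f y * h (phi t y)) \<longlongrightarrow> (LINT y|M. f y) * (LINT y|M. h y)) at_top"
proof (rule tendstoI)
  interpret prob_space M by fact
  fix e :: real assume e: "e > 0"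
  have K: "K \<ge> 0" using fK not_empty by fastforce
  \<comment> \<open>The second entry makes each of the two approximation errors at most
    \<open>e / 3\<close>; the last third is left for the convergence of the simple
    functions.\<close>
  define d where "d = min 1 (e / (3 * (2 * K + 1)))"
  have d: "d > 0" "d \<le> 1" using e K by (auto simp: d_def)
  have dK: "(2 * K + 1) * d \<le> e / 3"
  proof -
    have "(2 * K + 1) * d \<le> (2 * K + 1) * (e / (3 * (2 * K + 1)))"
      using K by (intro mult_left_mono) (auto simp: d_def)
    also have "\<dots> = e / 3"
    proof -
      have "L * (e / (3 * L)) = e / 3" if "L \<noteq> 0" for L :: real
        using that by simp
      then show ?thesis using K by (metis add_nonneg_pos less_irrefl mult_nonneg_nonneg zero_le_numeral zero_less_one)
    qed
    finally show ?thesis .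
  qed
  obtain s where s: "simple_function M s" "\<And>y. y \<in> space M \<Longrightarrow> \<bar>f y - s y\<bar> \<le> d"
    using uniform_simple_approximation[OF f fK d(1)] by blast
  obtain u where u: "simple_function M u" "\<And>y. y \<in> space M \<Longrightarrow> \<bar>h y - u y\<bar> \<le> d"
    using uniform_simple_approximation[OF h hK d(1)] by blast
  have [measurable]: "s \<in> borel_measurable M" "u \<in> borel_measurable M"
    using s u by (auto intro: borel_measurable_simple_function)
  have sK: "\<bar>s y\<bar> \<le> K + 1" if "y \<in> space M" for y
    using s(2)[OF that] fK[OF that] d by linarith
  have uK: "\<bar>u y\<bar> \<le> K + 1" if "y \<in> space M" for y
    using u(2)[OF that] hK[OF that] d by linarith
  have phi_space: "phi t y \<in> space M" if "y \<in> space M" for t y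
    using that measurable_space[OF meas] by blast
  have int: "integrable M k" if "k \<in> borel_measurable M" "\<And>y. y \<in> space M \<Longrightarrow> \<bar>k y\<bar> \<le> L" for k :: "'a \<Rightarrow> real" and L
    using that by (intro integrable_const_bound[of _ L]) auto
  have abs_int: "\<bar>LINT y|M. k y\<bar> \<le> L"
    if "k \<in> borel_measurable M" "\<And>y. y \<in> space M \<Longrightarrow> \<bar>k y\<bar> \<le> L" for k :: "'a \<Rightarrow> real" and L
  proof -
    have "norm (LINT y|M. k y) \<le> (LINT y|M. norm (k y))" by (rule integral_norm_bound)
    also have "\<dots> \<le> (LINT y|M. L)"
      using that int[OF that] by (intro integral_mono) auto
    finally show ?thesis by (simp add: prob_space)
  qed
  have intf: "integrable M f" "integrable M h" "integrable M s" "integrable M u"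
    using fK hK sK uK by (auto intro!: int[of f K] int[of h K] int[of s "K + 1"] int[of u "K + 1"])
  have close: "\<bar>(LINT y|M. f y * h (phi t y)) - (LINT y|M. s y * u (phi t y))\<bar> \<le> (2 * K + 1) * d" for t
  proof -
    have i: "integrable M (\<lambda>y. f y * h (phi t y))" "integrable M (\<lambda>y. s y * u (phi t y))"
      using int[of "\<lambda>y. f y * h (phi t y)" "K * K"] int[of "\<lambda>y. s y * u (phi t y)" "(K + 1) * (K + 1)"]
        fK hK sK uK phi_space K by (simp_all add: abs_mult mult_mono)
    have "\<bar>LINT y|M. f y * h (phi t y) - s y * u (phi t y)\<bar> \<le> (2 * K + 1) * d"
    proof (rule abs_int)
      fix y assume y: "y \<in> space M"
      note y' = phi_space[OF y]
      show "\<bar>f y * h (phi t y) - s y * u (phi t y)\<bar> \<le> (2 * K + 1) * d"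
        by (rule abs_mult_diff_le[OF s(2)[OF y] u(2)[OF y'] fK[OF y] hK[OF y'] d(2)])
    qed measurable
    then show ?thesis using i by simp
  qed
  have lim_close: "\<bar>(LINT y|M. f y) * (LINT y|M. h y) - (LINT y|M. s y) * (LINT y|M. u y)\<bar> \<le> (2 * K + 1) * d"
  proof (rule abs_mult_diff_le)
    show "\<bar>(LINT y|M. f y) - (LINT y|M. s y)\<bar> \<le> d"
      using abs_int[of "\<lambda>y. f y - s y"] s(2) intf by simp
    show "\<bar>(LINT y|M. h y) - (LINT y|M. u y)\<bar> \<le> d"
      using abs_int[of "\<lambda>y. h y - u y"] u(2) intf by simp
    show "\<bar>LINT y|M. f y\<bar> \<le> K" "\<bar>LINT y|M. h y\<bar> \<le> K"
      by (rule abs_int[OF f fK] abs_int[OF h hK]; assumption)+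
  qed (rule d)
  have "\<forall>\<^sub>F t in at_top. dist (LINT y|M. s y * u (phi t y)) ((LINT y|M. s y) * (LINT y|M. u y)) < e / 3"
    using mixing_simple_functions[OF assms(1) mix meas s(1) u(1)] e by (intro tendstoD) auto
  then show "\<forall>\<^sub>F t in at_top. dist (LINT y|M. f y * h (phi t y)) ((LINT y|M. f y) * (LINT y|M. h y)) < e"
  proof eventually_elim
    case (elim t)
    then show ?case using close[of t] lim_close dK unfolding dist_real_def by linarith
  qed
qed

text \<open>An atom of mass \<open>a\<close> returns to itself either fully or not at all, so its
  self-correlation takes only the values \<open>0\<close> and \<open>a\<close>, while mixing sends
  it to \<open>a * a\<close>. Hence \<open>a\<close> is 0 or 1, and mass 1 would make the measure
  Dirac.\<close>

lemma mixing_no_atom: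
  assumes "prob_space M" and mix: "flow_mixing M phi" and nd: "\<not> is_dirac M"
    and y: "y \<in> space M" and sy: "{y} \<in> sets M"
  shows "measure M {y} = 0"
proof (rule ccontr)
  interpret prob_space M by fact
  let ?a = "measure M {y}"
  assume nz: "?a \<noteq> 0"
  have "((\<lambda>t. measure M ({y} \<inter> (phi t -` {y} \<inter> space M))) \<longlongrightarrow> ?a * ?a) at_top"
    using mix sy unfolding flow_mixing_def by blast
  moreover have "measure M ({y} \<inter> (phi t -` {y} \<inter> space M)) \<in> {0, ?a}" for t
    using y by (cases "phi t y = y") auto
  \<comment> \<open>A finite set is closed, so it contains the limit of functions with values in
    it.\<close>
  ultimately have "?a * ?a \<in> {0, ?a}"
    by (intro Lim_in_closed_set[of "{0, ?a}" _ at_top]) auto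
  with nz have a1: "?a = 1" by simp
  have "emeasure M A = indicator A y" if A: "A \<in> sets M" for A
  proof (cases "y \<in> A")
    case True
    then have "1 \<le> measure M A" using a1 finite_measure_mono[of "{y}" A] A by simp
    then have "measure M A = 1" using prob_le_1[of A] by linarith
    with True show ?thesis by (simp add: emeasure_eq_measure)
  next
    case False
    then have "measure M {y} + measure M A = measure M ({y} \<union> A)"
      using A sy by (intro finite_measure_Union[symmetric]) auto
    then have "measure M A = 0" using a1 prob_le_1[of "{y} \<union> A"] measure_nonneg[of M A] by linarith
    with False show ?thesis by (simp add: emeasure_eq_measure)
  qed
  with y nd show False unfolding is_dirac_def by blast
qed

section \<open>Differentiation under the integral sign\<close>

lemma has_vector_derivative_iff_quotient:
  "(f has_vector_derivative D) (at t) \<longleftrightarrow> ((\<lambda>s. (f s - f t) /\<^sub>R (s - t)) \<longlongrightarrow> D) (at t)"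
proof -
  have "norm ((f s - f t) - (s - t) *\<^sub>R D) / norm (s - t) = norm ((f s - f t) /\<^sub>R (s - t) - D)"
    if "s \<noteq> t" for s
  proof -
    have "(f s - f t) /\<^sub>R (s - t) - D = ((f s - f t) - (s - t) *\<^sub>R D) /\<^sub>R (s - t)"
      using that by (simp add: scaleR_diff_right)
    then show ?thesis using that by (simp add: divide_inverse mult.commute)
  qed
  then have "((\<lambda>s. norm ((f s - f t) - (s - t) *\<^sub>R D) / norm (s - t)) \<longlongrightarrow> 0) (at t) \<longleftrightarrow>
      ((\<lambda>s. norm ((f s - f t) /\<^sub>R (s - t) - D)) \<longlongrightarrow> 0) (at t)"
    by (intro Lim_cong_within refl) auto
  then show ?thesis
    by (simp add: has_vector_derivative_def has_derivative_iff_norm bounded_linear_scaleR_left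
        tendsto_norm_zero_iff LIM_zero_iff)
qed

text \<open>The uniform bound on the derivative makes every \<open>K\<close> Lipschitz in time with
  constant \<open>C\<close>. The difference quotients are thus dominated by \<open>C\<close>, which
  is integrable for a finite measure, and dominated convergence applies along sequences.\<close>

lemma has_vector_derivative_integral:
  fixes K :: "real \<Rightarrow> 'a \<Rightarrow> 'b::{banach, second_countable_topology}"
  assumes "finite_measure M"
    and D: "\<And>t y. y \<in> space M \<Longrightarrow> ((\<lambda>s. K s y) has_vector_derivative K' t y) (at t)"
    and bd: "\<And>t y. y \<in> space M \<Longrightarrow> norm (K' t y) \<le> C"
    and [measurable]: "\<And>t. K' t \<in> borel_measurable M"
    and int: "\<And>t. integrable M (K t)"
  shows "((\<lambda>t. LINT y|M. K t y) has_vector_derivative (LINT y|M. K' t y)) (at t)"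
proof -
  interpret finite_measure M by fact
  have [measurable]: "K t \<in> borel_measurable M" for t using int by auto
  let ?q = "\<lambda>s y. (K s y - K t y) /\<^sub>R (s - t)"
  have lip: "norm (?q s y) \<le> C" if y: "y \<in> space M" and "s \<noteq> t" for s y
  proof -
    have "norm (K s y - K t y) \<le> C * norm (s - t)"
    proof (rule differentiable_bound[of UNIV _ "\<lambda>u h. h *\<^sub>R K' u y"])
      show "((\<lambda>s. K s y) has_derivative (\<lambda>h. h *\<^sub>R K' u y)) (at u within UNIV)" for u
        using D[OF y, of u] by (simp add: has_vector_derivative_def)
      show "onorm (\<lambda>h. h *\<^sub>R K' u y) \<le> C" for u
        using bd[OF y, of u] by (intro onorm_le) (metis mult.commute mult_right_mono norm_ge_zero norm_scaleR real_norm_def)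
    qed auto
    then have "norm (K s y - K t y) / norm (s - t) \<le> C"
      using that by (simp add: pos_divide_le_eq)
    then show ?thesis by (simp add: divide_inverse mult.commute)
  qed
  have "((\<lambda>s. LINT y|M. ?q s y) \<longlongrightarrow> (LINT y|M. K' t y)) (at t)"
    unfolding tendsto_at_iff_sequentially comp_def
  proof (intro allI impI)
    fix X assume X: "\<forall>i. X i \<in> UNIV - {t}" "X \<longlonglongrightarrow> t"
    show "(\<lambda>i. LINT y|M. ?q (X i) y) \<longlonglongrightarrow> (LINT y|M. K' t y)"
    proof (rule integral_dominated_convergence[where w = "\<lambda>_. C"])
      show "AE y in M. (\<lambda>i. ?q (X i) y) \<longlonglongrightarrow> K' t y"
      proof (rule AE_I2)
        fix y assume "y \<in> space M"
        from D[OF this, of t] have "((\<lambda>s. ?q s y) \<longlongrightarrow> K' t y) (at t)"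
          by (simp only: has_vector_derivative_iff_quotient)
        with X show "(\<lambda>i. ?q (X i) y) \<longlonglongrightarrow> K' t y"
          unfolding tendsto_at_iff_sequentially comp_def by blast
      qed
      show "AE y in M. norm (?q (X i) y) \<le> C" for i
        using X lip by (intro AE_I2) auto
    qed auto
  qed
  then show ?thesis
    using int by (simp add: has_vector_derivative_iff_quotient)
qed

section \<open>A point of the support, and the Gram matrix of centred powers\<close>

text \<open>Otherwise open sets of measure zero cover \<open>Lam\<close>, and a finite subcover
  makes the whole probability space null.\<close>

lemma compact_support_point:
  fixes M :: "'a::euclidean_space measure"
  assumes "prob_space M" and "compact Lam" and sp: "space M = Lam" and se: "sets M = sets (restrict_space borel Lam)"
  obtains a where "a \<in> Lam" "\<And>U. open U \<Longrightarrow> a \<in> U \<Longrightarrow> U \<inter> Lam \<notin> null_sets M"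
proof (rule ccontr)
  interpret prob_space M by fact
  let ?C = "{U. open U \<and> U \<inter> Lam \<in> null_sets M}"
  assume "\<not> thesis"
  with that have "\<exists>U. open U \<and> a \<in> U \<and> U \<inter> Lam \<in> null_sets M" if "a \<in> Lam" for a
    using \<open>a \<in> Lam\<close> by blast
  then have "Lam \<subseteq> \<Union>?C" by blast
  with \<open>compact Lam\<close> obtain D where D: "D \<subseteq> ?C" "finite D" "Lam \<subseteq> \<Union>D"
    by (elim compactE) auto
  have "(\<Union>U\<in>D. U \<inter> Lam) \<in> null_sets M"
    using D by (intro null_sets_UN' countable_finite) auto
  moreover have "(\<Union>U\<in>D. U \<inter> Lam) = space M" using D sp by auto
  ultimately show False using emeasure_space_1 by (auto simp: null_sets_def)
qed

text \<open>The unknown \<open>C\<close> solves a linear system whose matrix \<open>G\<close> is the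
  Gram matrix of the centred powers of \<open>P\<close>. A kernel vector gives a combination with
  zero L2 norm, that is, a polynomial vanishing almost surely at \<open>P\<close>. As
  \<open>P\<close> is not confined to a finite set, the polynomial is zero, so \<open>G\<close> is
  invertible.\<close>

lemma moment_matrix_solvable:
  fixes P :: "'a \<Rightarrow> real" and F :: "real^'q^'p" and e :: "'p::finite \<Rightarrow> nat"
  assumes "prob_space M" and int: "\<And>n. integrable M (\<lambda>y. P y ^ n)"
    and inf: "\<And>S. finite S \<Longrightarrow> \<not> (AE y in M. P y \<in> S)"
    and e: "inj e" "\<And>k. e k > 0"
  shows "\<exists>C :: real^'q^'p. \<forall>i j. (LINT y|M. (P y ^ e i - (LINT z|M. P z ^ e i)) * (\<Sum>k\<in>UNIV. C $ k $ j * P y ^ e k)) = F $ i $ j"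
proof -
  interpret prob_space M by fact
  define m where "m i = (LINT z|M. P z ^ e i)" for i
  define u where "u i y = P y ^ e i - m i" for i y
  have intP: "integrable M (\<lambda>y. u i y * P y ^ n)" for i n
    using int by (simp add: u_def left_diff_distrib flip: power_add)
  have intu: "integrable M (u i)" for i
    using intP[of i 0] by simp
  have intuu: "integrable M (\<lambda>y. u i y * u k y)" for i k
    using intP[of i "e k"] intu[of i] unfolding u_def[of k] by (simp add: right_diff_distrib)
  have u0: "(LINT y|M. u i y) = 0" for i
    using int by (simp add: u_def m_def prob_space)
  define G :: "real^'p^'p" where "G = (\<chi> i k. LINT y|M. u i y * P y ^ e k)"
  \<comment> \<open>Since \<open>u i\<close> has mean zero, centring the second factor as well does
    not change the integral; this exhibits \<open>G\<close> as a Gram matrix.\<close>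
  have G: "G $ i $ k = (LINT y|M. u i y * u k y)" for i k
    using intP[of i "e k"] intu[of i] u0[of i] unfolding u_def[of k] by (simp add: G_def right_diff_distrib)
  have "x = 0" if x: "G *v x = 0" for x
  proof -
    let ?s = "\<lambda>y. \<Sum>k\<in>UNIV. x $ k * u k y"
    have sq: "(?s y)\<^sup>2 = (\<Sum>i\<in>UNIV. \<Sum>k\<in>UNIV. x $ i * x $ k * (u i y * u k y))" for y
      by (simp add: power2_eq_square sum_product mult_ac)
    have ints: "integrable M (\<lambda>y. (?s y)\<^sup>2)"
      unfolding sq by (intro Bochner_Integration.integrable_sum integrable_mult_right intuu)
    have "(LINT y|M. (?s y)\<^sup>2) = (\<Sum>i\<in>UNIV. \<Sum>k\<in>UNIV. x $ i * x $ k * G $ i $ k)"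
      unfolding sq by (simp add: Bochner_Integration.integral_sum Bochner_Integration.integrable_sum intuu G)
    also have "\<dots> = (\<Sum>i\<in>UNIV. x $ i * (G *v x) $ i)"
      by (simp add: matrix_vector_mult_def sum_distrib_left mult_ac)
    finally have "(LINT y|M. (?s y)\<^sup>2) = 0" using x by simp
    then have "AE y in M. (?s y)\<^sup>2 = 0"
      using integral_nonneg_eq_0_iff_AE[OF ints] by simp
    define p where "p = (\<Sum>k\<in>UNIV. monom (x $ k) (e k)) - [:\<Sum>k\<in>UNIV. x $ k * m k:]"
    have "poly p (P y) = ?s y" for y
      by (simp add: p_def u_def poly_sum poly_monom sum_subtractf right_diff_distrib)
    then have "AE y in M. P y \<in> {z. poly p z = 0}"
      using \<open>AE y in M. (?s y)\<^sup>2 = 0\<close> by simp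
    then have p: "p = 0" using inf poly_roots_finite by blast
    \<comment> \<open>Positive exponents keep the constant term of \<open>p\<close> out of these
      coefficients, and injectivity of \<open>e\<close> keeps the monomials from merging.\<close>
    have "x $ i = coeff p (e i)" for i
    proof -
      have "coeff p (e i) = (\<Sum>k\<in>UNIV. if e k = e i then x $ k else 0)"
        using e(2)[of i] by (simp add: p_def coeff_sum coeff_pCons split: nat.splits)
      then show ?thesis by (simp add: inj_eq[OF e(1)])
    qed
    then show ?thesis using p by (simp add: vec_eq_iff)
  qed
  then obtain B where "B ** G = mat 1" using matrix_left_invertible_ker by blast
  then have GB: "G ** B = mat 1" using matrix_left_right_inverse by blast
  have "(LINT y|M. u i y * (\<Sum>k\<in>UNIV. (B ** F) $ k $ j * P y ^ e k)) = F $ i $ j" for i j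
  proof -
    have "(LINT y|M. u i y * (\<Sum>k\<in>UNIV. (B ** F) $ k $ j * P y ^ e k)) =
        (LINT y|M. (\<Sum>k\<in>UNIV. (B ** F) $ k $ j * (u i y * P y ^ e k)))"
      by (simp add: sum_distrib_left mult_ac)
    also have "\<dots> = (\<Sum>k\<in>UNIV. G $ i $ k * (B ** F) $ k $ j)"
      using intP by (subst Bochner_Integration.integral_sum) (simp_all add: G_def mult.commute)
    also have "\<dots> = (G ** (B ** F)) $ i $ j"
      by (simp add: matrix_matrix_mult_def)
    also have "\<dots> = F $ i $ j"
      by (simp add: matrix_mul_assoc GB)
    finally show ?thesis .
  qed
  then show ?thesis unfolding u_def m_def by blast
qed

lemma bounded_bilinear_outer: "bounded_bilinear (outer :: real^'p \<Rightarrow> real^'q \<Rightarrow> real^'q^'p)"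
proof -
  have "bilinear (outer :: real^'p \<Rightarrow> real^'q \<Rightarrow> real^'q^'p)"
    unfolding bilinear_def
    by (auto intro!: linearI simp: outer_def vec_eq_iff algebra_simps)
  then show ?thesis by (simp add: bilinear_conv_bounded_bilinear)
qed

lemma continuous_on_measurable_restrict:
  assumes "sets M = sets (restrict_space borel S)" "continuous_on S f"
  shows "f \<in> borel_measurable M"
  using borel_measurable_continuous_on_restrict[OF assms(2)] measurable_cong_sets[OF assms(1) refl] by blast

lemma integrable_continuous_on_compact:
  fixes f :: "'a::euclidean_space \<Rightarrow> 'b::{banach, second_countable_topology}"
  assumes "prob_space M" "compact (space M)" "sets M = sets (restrict_space borel (space M))"
    and "continuous_on (space M) f"
  shows "integrable M f"
proof -
  interpret prob_space M by fact
  have "bounded (f ` space M)"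
    using assms compact_continuous_image compact_imp_bounded by blast
  then obtain K where "\<And>y. y \<in> space M \<Longrightarrow> norm (f y) \<le> K"
    unfolding bounded_iff by blast
  then show ?thesis
    using continuous_on_measurable_restrict[OF assms(3,4)] by (intro integrable_const_bound[of _ K]) auto
qed

theorem theorem4p3:
  fixes r :: nat
    and Lam :: "(real^'m::finite) set"
    and g :: "real^'m::finite \<Rightarrow> real^'m"
    and phi :: "real \<Rightarrow> real^'m::finite \<Rightarrow> real^'m"
    and M :: "(real^'m::finite) measure"
    and R :: "real^'m::finite^'m"
    and F :: "real^'q^'p"
  assumes r: "r \<ge> 1"
    and Lam: "compact Lam"
    and g: "Ck r g"
    and flow: "is_flow_on g Lam phi"
    and space: "space M = Lam"
    and sets: "sets M = sets (restrict_space borel Lam)"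
    and prob: "prob_space M"
    and inv: "flow_invariant M phi"
    and erg: "flow_ergodic M phi"
    and mix: "flow_mixing M phi"
    and R2: "R ** R = mat 1"
    and RLam: "(\<lambda>y. R *v y) ` Lam = Lam"
    and Rinv: "measure_preserving M (\<lambda>y. R *v y)"
    and rev: "\<forall>y\<in>Lam. g (R *v y) = - (R *v g y)"
    and nondirac: "\<not> is_dirac M"
  shows "\<exists>v :: real^'m::finite \<Rightarrow> (real^'p::finite) \<times> (real^'q::finite). admissible r R M v \<and> E0_eq M phi v F"
proof -
  interpret prob_space M by fact
  have RR: "R *v (R *v y) = y" for y
    by (simp add: matrix_vector_mul_assoc R2)
  have RL: "R *v y \<in> Lam" if "y \<in> Lam" for y using that RLam by blast
  have phiL: "phi t y \<in> Lam" if "y \<in> Lam" for t y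
    using that flow unfolding is_flow_on_def by blast
  have phi_meas [measurable]: "phi t \<in> measurable M M" for t
    using inv unfolding flow_invariant_def measure_preserving_def by blast
  have meas: "f \<in> borel_measurable M" if "continuous_on Lam f"
    for f :: "real^'m \<Rightarrow> 'z::topological_space"
    using that sets by (rule continuous_on_measurable_restrict[rotated])
  have int: "integrable M f" if "continuous_on Lam f"
    for f :: "real^'m \<Rightarrow> 'z::{banach, second_countable_topology}"
    using that Lam sets space prob by (intro integrable_continuous_on_compact) auto
  have bound: "\<exists>K. \<forall>y\<in>Lam. norm (f y) \<le> K" if "continuous_on Lam f"
    for f :: "real^'m \<Rightarrow> 'z::real_normed_vector"
    using compact_imp_bounded[OF compact_continuous_image[OF that Lam]] unfolding bounded_iff by blast

  \<comment> \<open>An \<open>R\<close>-even polynomial that takes infinitely many values\<close>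
  obtain a where a: "a \<in> Lam" and supp: "\<And>U. open U \<Longrightarrow> a \<in> U \<Longrightarrow> U \<inter> Lam \<notin> null_sets M"
    using compact_support_point[OF prob Lam space sets] by blast
  \<comment> \<open>The second factor is the first one composed with \<open>R\<close>, so
    \<open>P\<close> is even because \<open>R\<close> is an involution. Its only zeros are
    \<open>a\<close> and \<open>R *v a\<close>.\<close>
  define P where "P y = ((y - a) \<bullet> (y - a)) * ((R *v y - a) \<bullet> (R *v y - a))" for y
  \<comment> \<open>The derivative of \<open>P\<close> in the direction \<open>g y\<close>. No
    derivative of \<open>g\<close> enters, so \<open>Q\<close> keeps the regularity
    \<open>r\<close>.\<close>
  define Q where "Q y = 2 * ((y - a) \<bullet> g y) * ((R *v y - a) \<bullet> (R *v y - a))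
      + 2 * ((y - a) \<bullet> (y - a)) * ((R *v y - a) \<bullet> (R *v g y))" for y
  have blR: "bounded_linear (\<lambda>y. R *v y)" by (rule matrix_vector_mul_bounded_linear)
  have CkP: "Ck k P" for k
    unfolding P_def by (intro Ck_bounded_bilinear[OF bounded_bilinear_mult]
        Ck_bounded_bilinear[OF bounded_bilinear_inner] Ck_diff Ck_const Ck_linear blR bounded_linear_ident)
  have CkQ: "Ck r Q"
    unfolding Q_def by (intro Ck_add Ck_bounded_bilinear[OF bounded_bilinear_mult]
        Ck_bounded_bilinear[OF bounded_bilinear_inner] Ck_diff Ck_const Ck_linear g
        Ck_bounded_linear[OF blR] blR bounded_linear_ident)
  have PR: "P (R *v y) = P y" for y by (simp add: P_def RR mult.commute)
  \<comment> \<open>Reversibility turns \<open>g (R *v y)\<close> into \<open>- (R *v g y)\<close>,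
    so that applying \<open>R\<close> exchanges the two summands of \<open>Q\<close> and flips their
    sign.\<close>
  have QR: "Q (R *v y) = - Q y" if "y \<in> Lam" for y
    using that rev RR[of "g y"] by (simp add: Q_def RR vec.neg)
  have P_deriv: "((\<lambda>s. P (phi s y)) has_real_derivative Q (phi t y)) (at t)" if "y \<in> Lam" for y t
  proof -
    have D: "((\<lambda>s. phi s y) has_derivative (\<lambda>h. h *\<^sub>R g (phi t y))) (at t)"
      using flow that unfolding is_flow_on_def has_vector_derivative_def by blast
    have DR: "((\<lambda>s. R *v phi s y) has_derivative (\<lambda>h. R *v (h *\<^sub>R g (phi t y)))) (at t)"
      by (rule bounded_linear.has_derivative[OF blR D])
    show ?thesis
      unfolding P_def Q_def has_field_derivative_def
      by (rule derivative_eq_intros D DR refl)+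
        (simp add: fun_eq_iff algebra_simps inner_commute matrix_vector_mult_scaleR)
  qed
  have P_range: "\<not> (AE y in M. P y \<in> S)" if S: "finite S" for S
  proof
    assume AE: "AE y in M. P y \<in> S"
    have P0: "P y \<ge> 0" for y by (simp add: P_def)
    \<comment> \<open>Below this threshold the only nonnegative value that \<open>S\<close> can
      contain is 0; inserting 1 keeps the minimum over a nonempty set.\<close>
    define eps where "eps = Min (insert 1 (S \<inter> {0<..}))"
    have eps: "eps > 0" using S by (auto simp: eps_def)
    have small: "z = 0" if "z \<in> S" "z < eps" "z \<ge> 0" for z
      using that S by (auto simp: eps_def)
    have zero: "y \<in> {a, R *v a}" if "P y = 0" for y
      using that RR[of y] by (auto simp: P_def)
    have "{y} \<in> null_sets M" if "y \<in> Lam" for y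
    proof -
      have "{y} \<in> sets M"
        unfolding sets sets_restrict_space using that by (intro image_eqI[of _ _ "{y}"]) auto
      with mixing_no_atom[OF prob mix nondirac] that space show ?thesis
        by (auto simp: null_sets_def emeasure_eq_measure)
    qed
    then have "{a} \<union> {R *v a} \<in> null_sets M" using a RL by (intro null_sets.Un) auto
    then have "AE y in M. y \<notin> {a} \<union> {R *v a}" by (rule AE_not_in)
    \<comment> \<open>A value of \<open>P\<close> in \<open>S\<close> below \<open>eps\<close> is 0,
      which happens only at \<open>a\<close> and \<open>R *v a\<close>, both null. This contradicts
      the choice of \<open>a\<close>, since \<open>P\<close> is below \<open>eps\<close> on an open
      neighbourhood of \<open>a\<close>.\<close>
    with AE have ae: "AE y in M. \<not> P y < eps"
    proof eventually_elim
      case (elim y)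
      then show ?case using small[of "P y"] P0[of y] zero[of y] by auto
    qed
    let ?U = "{y. P y < eps}"
    have "open ?U"
      using Ck_imp_continuous_on[OF CkP] by (intro open_Collect_less continuous_on_const)
    then have "?U \<inter> Lam \<in> sets M"
      unfolding sets sets_restrict_space by (intro image_eqI[of _ _ ?U]) auto
    then have "?U \<inter> Lam \<in> null_sets M"
      using ae space by (subst AE_iff_null_sets) (auto elim: eventually_mono)
    with supp[OF \<open>open ?U\<close>] eps show False by (simp add: P_def)
  qed

  \<comment> \<open>Construction of the observable from powers of \<open>P\<close>\<close>
  obtain e0 :: "'p \<Rightarrow> nat" where "inj e0" using finite_imp_inj_to_nat_seg[of "UNIV :: 'p set"] by auto
  \<comment> \<open>The shift avoids exponent 0, whose centred power would vanish.\<close>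
  define e where "e k = Suc (e0 k)" for k
  have e: "inj e" "\<And>k. e k > 0" using \<open>inj e0\<close> by (auto simp: e_def inj_def)
  define m where "m i = (LINT z|M. P z ^ e i)" for i
  have contP: "continuous_on S P" for S by (rule Ck_imp_continuous_on[OF CkP])
  have contQ: "continuous_on S Q" for S by (rule Ck_imp_continuous_on[OF CkQ])
  have intP: "integrable M (\<lambda>y. P y ^ n)" for n
    by (intro int continuous_on_power contP)
  \<comment> \<open>The target \<open>- F / 2\<close> compensates the factor 2 in the definition of
    \<open>E0_eq\<close> and the sign from the boundary term at time 0.\<close>
  obtain C :: "real^'q^'p" where C: "\<And>i j. (LINT y|M. (P y ^ e i - m i) * (\<Sum>k\<in>UNIV. C $ k $ j * P y ^ e k)) = - F $ i $ j / 2"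
    using moment_matrix_solvable[OF prob intP P_range e, of "\<chi> i j. - F $ i $ j / 2"] unfolding m_def by auto

  \<comment> \<open>The even part \<open>u\<close> collects the centred powers, \<open>W\<close> is
    the even potential with coefficient rows \<open>C $ k\<close>, and \<open>w\<close> is the
    derivative of \<open>W\<close> along the vector field \<open>g\<close>.\<close>
  define u :: "real^'m \<Rightarrow> real^'p" where "u y = (\<chi> i. P y ^ e i - m i)" for y
  define W :: "real^'m \<Rightarrow> real^'q" where "W y = (\<Sum>k\<in>UNIV. (P y ^ e k) *\<^sub>R C $ k)" for y
  define w :: "real^'m \<Rightarrow> real^'q" where "w y = (\<Sum>k\<in>UNIV. (real (e k) * P y ^ (e k - 1) * Q y) *\<^sub>R C $ k)" for y
  have Cku: "Ck k u" for k
    unfolding u_def by (intro Ck_vec Ck_diff Ck_power Ck_const CkP)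
  have CkW: "Ck k W" for k
    unfolding W_def by (intro Ck_sum Ck_bounded_linear[OF bounded_linear_scaleR_left] Ck_power CkP)
  have Ckw: "Ck r w"
    unfolding w_def by (intro Ck_sum Ck_bounded_linear[OF bounded_linear_scaleR_left]
        Ck_bounded_bilinear[OF bounded_bilinear_mult] Ck_power Ck_const CkP CkQ)
  have cont: "continuous_on S u" "continuous_on S W" "continuous_on S w" for S
    using Ck_imp_continuous_on Cku CkW Ckw by blast+
  note [measurable] = cont[THEN meas]
  have wR: "w (R *v y) = - w y" if "y \<in> Lam" for y
    using QR[OF that] by (simp add: w_def PR sum_negf)
  have W_deriv: "((\<lambda>s. W (phi s y)) has_vector_derivative w (phi t y)) (at t)" if "y \<in> Lam" for y t
    unfolding W_def w_def
    by (intro has_vector_derivative_sum bounded_linear.has_vector_derivative[OF bounded_linear_scaleR_left])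
      (auto simp: has_real_derivative_iff_has_vector_derivative[symmetric]
        intro!: derivative_eq_intros P_deriv[OF that])
  have u_mean: "(LINT y|M. u y $ i) = 0" for i
    using intP by (simp add: u_def m_def prob_space)
  define v where "v y = (u y, w y)" for y

  \<comment> \<open>Admissibility: regularity, parity and zero mean\<close>
  have "admissible r R M v"
    unfolding admissible_def
  proof (intro conjI ballI)
    show "Ck r v" unfolding v_def by (intro Ck_Pair Cku Ckw)
    show "v (R *v y) = Adiag (v y)" if "y \<in> space M" for y
      using that space wR by (simp add: v_def Adiag_def u_def PR)
    have iu: "integrable M u" by (intro int cont)
    have iv: "integrable M v" unfolding v_def by (intro int continuous_on_Pair cont)
    have "(LINT y|M. u y) $ i = 0" for i
      using integral_bounded_linear[OF bounded_linear_vec_nth iu, of i] u_mean[of i] by simp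
    then have u0: "(LINT y|M. u y) = 0" by (simp add: vec_eq_iff)
    \<comment> \<open>By invariance under \<open>R\<close> the mean of the odd function
      \<open>w\<close> equals its own negative.\<close>
    have "(LINT y|M. w y) = (LINT y|distr M M (\<lambda>y. R *v y). w y)"
      using Rinv by (simp add: measure_preserving_def)
    also have "\<dots> = (LINT y|M. w (R *v y))"
      using Rinv by (intro integral_distr) (auto simp: measure_preserving_def)
    also have "\<dots> = (LINT y|M. - w y)"
      using wR space by (intro Bochner_Integration.integral_cong) auto
    finally have "2 *\<^sub>R (LINT y|M. w y) = 0" by (simp add: scaleR_2)
    then have w0: "(LINT y|M. w y) = 0" by simp
    have "(\<lambda>y. fst (v y)) = u" "(\<lambda>y. snd (v y)) = w" by (simp_all add: v_def)
    then show "(LINT y|M. v y) = 0"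
      using integral_bounded_linear[OF bounded_linear_fst iv] integral_bounded_linear[OF bounded_linear_snd iv] u0 w0
      by (simp add: prod_eq_iff)
  qed

  \<comment> \<open>Evaluation of the limit by telescoping and mixing\<close>
  moreover have "E0_eq M phi v F"
  proof -
    interpret O: bounded_bilinear "outer :: real^'p \<Rightarrow> real^'q \<Rightarrow> real^'q^'p"
      by (rule bounded_bilinear_outer)
    \<comment> \<open>An antiderivative in time of the correlation of \<open>u\<close> with
      \<open>w\<close>; the integral up to \<open>T\<close> is then
      \<open>H T - H 0\<close>.\<close>
    define H where "H t = (LINT y|M. outer (u y) (W (phi t y)))" for t
    obtain Ku where Ku: "\<And>y. y \<in> Lam \<Longrightarrow> norm (u y) \<le> Ku" using bound[OF cont(1)] by blast
    obtain KW where KW: "\<And>y. y \<in> Lam \<Longrightarrow> norm (W y) \<le> KW" using bound[OF cont(2)] by blast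
    obtain Kw where Kw: "\<And>y. y \<in> Lam \<Longrightarrow> norm (w y) \<le> Kw" using bound[OF cont(3)] by blast
    obtain KO where KO: "KO \<ge> 0" "\<And>x z. norm (outer x z :: real^'q^'p) \<le> norm x * norm z * KO"
      using O.nonneg_bounded by blast
    have outer_bound: "norm (outer x z :: real^'q^'p) \<le> Ku * L * KO" if "norm x \<le> Ku" "norm z \<le> L" for x z L
    proof -
      have "norm x * norm z \<le> Ku * L"
        using that norm_ge_zero[of x] by (intro mult_mono norm_ge_zero) linarith+
      then show ?thesis using KO order_trans mult_right_mono by blast
    qed
    have cont_outer: "continuous_on UNIV (\<lambda>p. outer (fst p) (snd p) :: real^'q^'p)"
      by (intro O.continuous_on continuous_intros)
    have outer_meas: "(\<lambda>y. outer (f y) (h y) :: real^'q^'p) \<in> borel_measurable M"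
      if "f \<in> borel_measurable M" "h \<in> borel_measurable M" for f h
      using borel_measurable_continuous_Pair[OF that cont_outer] by simp
    \<comment> \<open>Invariance of \<open>Lam\<close> under the flow gives bounds uniform in time,
      and \<open>phi t\<close> is measurable.\<close>
    have int_H: "integrable M (\<lambda>y. outer (u y) (W (phi t y)))" for t
      by (intro integrable_const_bound[of _ "Ku * KW * KO"] AE_I2 outer_bound outer_meas Ku KW phiL)
        (auto simp: space)
    have corr_eq: "corr M phi v t = (LINT y|M. outer (u y) (w (phi t y)))" for t
      by (simp add: corr_def v_def)
    have H_deriv: "(H has_vector_derivative corr M phi v t) (at t)" for t
      unfolding H_def corr_eq
    proof (rule has_vector_derivative_integral[of M _ _ "Ku * Kw * KO"])
      show "((\<lambda>s. outer (u y) (W (phi s y))) has_vector_derivative outer (u y) (w (phi t y))) (at t)"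
        if "y \<in> space M" for t y
        using that space by (intro bounded_linear.has_vector_derivative[OF O.bounded_linear_right] W_deriv) simp
      show "norm (outer (u y) (w (phi t y))) \<le> Ku * Kw * KO" if "y \<in> space M" for t y
        using that space by (intro outer_bound Ku Kw phiL) simp_all
      show "(\<lambda>y. outer (u y) (w (phi t y))) \<in> borel_measurable M" for t
        by (intro outer_meas) measurable
    qed (use int_H finite_measure_axioms in auto)
    have FTC: "(corr M phi v has_integral (H T - H 0)) {0..T}" if "T \<ge> 0" for T
      using that has_vector_derivative_at_within[OF H_deriv] by (rule fundamental_theorem_of_calculus)
    have H_comp: "H t $ i $ j = (LINT y|M. u y $ i * W (phi t y) $ j)" for t i j
      using integral_bounded_linear[OF bounded_linear_compose[OF bounded_linear_vec_nth bounded_linear_vec_nth] int_H]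
      by (simp add: H_def outer_def)
    \<comment> \<open>Componentwise, mixing gives the product of the means as the limit, and
      \<open>u\<close> has mean zero.\<close>
    have "(H \<longlongrightarrow> 0) at_top"
    proof (intro vec_tendstoI)
      fix i j
      have "((\<lambda>t. LINT y|M. u y $ i * W (phi t y) $ j) \<longlongrightarrow> (LINT y|M. u y $ i) * (LINT y|M. W y $ j)) at_top"
      proof (rule mixing_bounded_functions[OF prob mix phi_meas])
        show "(\<lambda>y. u y $ i) \<in> borel_measurable M" "(\<lambda>y. W y $ j) \<in> borel_measurable M"
          by (intro meas continuous_on_component cont)+
        show "\<bar>u y $ i\<bar> \<le> max Ku KW" "\<bar>W y $ j\<bar> \<le> max Ku KW" if "y \<in> space M" for y
          using that space Ku[of y] KW[of y] component_le_norm_cart[of "u y" i] component_le_norm_cart[of "W y" j]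
          by simp_all
      qed
      then show "((\<lambda>t. H t $ i $ j) \<longlongrightarrow> 0 $ i $ j) at_top"
        by (simp add: H_comp u_mean)
    qed
    then have lim: "((\<lambda>T. 2 *\<^sub>R (H T - H 0)) \<longlongrightarrow> 2 *\<^sub>R (0 - H 0)) at_top"
      by (intro tendsto_intros)
    have phi0: "phi 0 y = y" if "y \<in> Lam" for y
      using that flow unfolding is_flow_on_def by blast
    have "H 0 $ i $ j = - F $ i $ j / 2" for i j
    proof -
      have "H 0 $ i $ j = (LINT y|M. (P y ^ e i - m i) * (\<Sum>k\<in>UNIV. C $ k $ j * P y ^ e k))"
        unfolding H_comp using phi0 space
        by (intro Bochner_Integration.integral_cong) (auto simp: u_def W_def mult.commute)
      then show ?thesis by (simp add: C)
    qed
    then have "2 *\<^sub>R (0 - H 0) = F" by (simp add: vec_eq_iff)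
    \<comment> \<open>The integral formula holds for \<open>T \<ge> 0\<close>, which suffices for
      the limit at infinity.\<close>
    moreover have "\<forall>\<^sub>F T in at_top. 2 *\<^sub>R (H T - H 0) = 2 *\<^sub>R integral {0..T} (corr M phi v)"
      using eventually_ge_at_top[of 0] by eventually_elim (simp add: integral_unique[OF FTC])
    ultimately have "((\<lambda>T. 2 *\<^sub>R integral {0..T} (corr M phi v)) \<longlongrightarrow> F) at_top"
      using Lim_transform_eventually[OF lim] by simp
    then show ?thesis
      unfolding E0_eq_def using FTC by (auto intro: has_integral_integrable)
  qed
  ultimately show ?thesis by blast
qed

end
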